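(* Let $d\ge2$ and let $\mu$ be a positive Borel measure on $\mathbb{R}^d$ with $\mu(E)=1$, where $E$ is its support, and assume there exist $0<\alpha\le d$ and $c_0>0$ with $\mu(B(x,r))\le c_0r^\alpha$ for every open ball $B(x,r)$. Assume $E\subseteq B(0,r_0)$. Then there exists $c>0$ such that for every $N$ and every point distribution $\mathcal{P}_N=\{z_1,\dots,z_N\}\subset B(0,r_0)$, $$\left\{\int_0^{+\infty}\int_{\Sigma_{d-1}}\left|\mathcal{D}_N(\Pi(\rho,\Theta))\right|^2d\Theta\,d\rho\right\}^{1/2}\ge c\,N^{1/2-1/(2\alpha)}.$$
   Context: $\Sigma_{d-1}$ is the unit sphere in $\mathbb{R}^d$ with its normalized surface measure $d\Theta$. For $\rho\in\mathbb{R}$, $\Theta\in\Sigma_{d-1}$, $\Pi(\rho,\Theta)=\{x\in\mathbb{R}^d: x\cdot\Theta>\rho\}$, and $\mathcal{D}_N(\Pi(\rho,\Theta))=\sum_{j=1}^N\chi_{\Pi(\rho,\Theta)}(z_j)-N\mu(\Pi(\rho,\Theta))$. *)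

theory Defs
  imports "HOL-Analysis.Analysis"
begin

definition measure_support :: "'a::metric_space measure \<Rightarrow> 'a set" where
  "measure_support \<mu> = {x. \<forall>r>0. emeasure \<mu> (ball x r) > 0}"

text \<open>Normalized surface measure on the unit sphere of 'a: the push-forward of the
  normalized Lebesgue measure on the unit ball under radial projection x \<mapsto> x/|x|
  (the cone-measure construction of the normalized surface measure).\<close>
definition sphere_measure :: "'a::euclidean_space measure" where
  "sphere_measure = distr (uniform_measure lborel (ball 0 1)) borel (\<lambda>x. x /\<^sub>R norm x)"

definition halfspace :: "real \<Rightarrow> 'a::euclidean_space \<Rightarrow> 'a set" where
  "halfspace \<rho> \<Theta> = {x. x \<bullet> \<Theta> > \<rho>}"

definition discrepancy :: "'a measure \<Rightarrow> nat \<Rightarrow> (nat \<Rightarrow> 'a) \<Rightarrow> 'a set \<Rightarrow> real" where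
  "discrepancy \<mu> N z A = (\<Sum>j<N. indicator A (z j)) - real N * measure \<mu> A"

end

theory Submission
  imports Defs "HOL-Probability.Probability"
begin

text \<open>
  Let \<open>P\<close> be the empirical measure of the points, \<open>\<nu> = P - \<mu>\<close> and write \<open>Q(K) = \<integral>\<integral> K d\<nu> d\<nu>\<close> for the energy
  with respect to a kernel \<open>K\<close>. Averaging the squared discrepancy over half-spaces, and pairing
  \<open>\<Theta>\<close> with \<open>-\<Theta>\<close>, gives \<open>- c N\<^sup>2 Q(|x - y|)\<close> with \<open>c > 0\<close>: the terms depending on \<open>x\<close> or \<open>y\<close> alone
  drop out because \<open>\<nu>\<close> has total mass \<open>0\<close>.

  Let \<open>g\<close> be the autocorrelation of a radial tent function. Then \<open>g\<close> is radial, nonnegative,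
  supported in the ball of radius \<open>2\<close>, and \<open>g(0) - g(u) = O(|u|\<^sup>2)\<close>, so by scaling
  \<open>\<integral>\<^sub>0\<^sup>\<infinity> (g(0) - g(v/t)) dt = C |v|\<close> and hence \<open>- C Q(|x - y|) = \<integral>\<^sub>0\<^sup>\<infinity> Q(g((x - y)/t)) dt\<close>.
  Every \<open>Q(g((x - y)/t))\<close> is an integral of squares, hence nonnegative; and for
  \<open>t\<close> up to a small multiple of \<open>N powr (- 1/\<alpha>)\<close> the diagonal terms of \<open>P \<times> P\<close> contribute at least \<open>g(0)/N\<close>, while the growth
  condition on \<open>\<mu>\<close> bounds the cross terms by half of that. Thus \<open>- C N\<^sup>2 Q(|x - y|)\<close> is at least a
  constant times \<open>N\<^sup>2 \<cdot> N powr (- 1/\<alpha>) / N = N powr (1 - 1/\<alpha>)\<close>.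
\<close>

section \<open>Lebesgue measure and orthogonal transformations\<close>

lemma nn_integral_lborel_translate:
  fixes f :: "'a::euclidean_space \<Rightarrow> ennreal"
  assumes [measurable]: "f \<in> borel_measurable borel"
  shows "(\<integral>\<^sup>+x. f (a + x) \<partial>lborel) = (\<integral>\<^sup>+x. f x \<partial>lborel)"
proof -
  have "(\<integral>\<^sup>+x. f x \<partial>lborel) = (\<integral>\<^sup>+x. f x \<partial>distr lborel borel ((+) a))"
    by (simp add: lborel_distr_plus)
  then show ?thesis by (simp add: nn_integral_distr)
qed

lemma integral_lborel_translate:
  fixes f :: "'a::euclidean_space \<Rightarrow> real"
  assumes [measurable]: "f \<in> borel_measurable borel"
  shows "(\<integral>x. f (a + x) \<partial>lborel) = (\<integral>x. f x \<partial>lborel)"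
proof -
  have "(\<integral>x. f x \<partial>lborel) = (\<integral>x. f x \<partial>distr lborel borel ((+) a))"
    by (simp add: lborel_distr_plus)
  then show ?thesis by (simp add: integral_distr)
qed

lemma orthogonal_transformation_measurable:
  fixes T :: "'a::euclidean_space \<Rightarrow> 'a"
  assumes "orthogonal_transformation T"
  shows "T \<in> borel_measurable borel"
  using assms by (intro borel_measurable_continuous_onI linear_continuous_on
    linear_conv_bounded_linear[THEN iffD1] orthogonal_transformation_linear)

lemma emeasure_lborel_unit_ball:
  "emeasure lborel (ball (0::'a::euclidean_space) 1) \<noteq> 0"
  "emeasure lborel (ball (0::'a::euclidean_space) 1) \<noteq> \<infinity>"
  using emeasure_lborel_ball_finite[of "0::'a" 1] content_ball_pos[of 1 "0::'a"]
  by (auto simp: measure_def)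

text \<open>
  Uniqueness of Haar measure: for Borel sets \<open>A\<close> and the unit ball \<open>B\<close>, translation invariance and
  Fubini give \<open>T\<^sub>*\<lambda>(A) \<lambda>(B) = \<lambda>(A) T\<^sub>*\<lambda>(B)\<close>, and \<open>T\<^sub>*\<lambda>(B) = \<lambda>(B)\<close>.
\<close>

lemma lborel_distr_orthogonal:
  fixes T :: "'a::euclidean_space \<Rightarrow> 'a"
  assumes T: "orthogonal_transformation T"
  shows "distr lborel borel T = lborel"
proof (rule measure_eqI)
  fix A :: "'a set" assume "A \<in> sets (distr lborel borel T)"
  then have A[measurable]: "A \<in> sets borel" by simp
  have [measurable]: "T \<in> borel_measurable borel"
    by (rule orthogonal_transformation_measurable[OF T])
  have lin: "linear T" using T by (rule orthogonal_transformation_linear)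
  define B where "B = ball (0::'a) 1"
  have [measurable]: "B \<in> sets borel" by (simp add: B_def)
  have B_sym: "indicator B (u - v) = (indicator B (v - u) :: ennreal)" for u v
    by (simp add: B_def indicator_def norm_minus_commute)
  have B_T: "indicator B (T x) = (indicator B x :: ennreal)" for x
    by (simp add: B_def indicator_def orthogonal_transformation_norm[OF T])
  \<comment> \<open>Surjectivity gives \<open>y = T u\<close>; shifting \<open>x\<close> by
    \<open>u\<close> then moves \<open>y\<close> from the argument of \<open>B\<close> to that of
    \<open>A\<close>.\<close>
  have translate: "(\<integral>\<^sup>+x. indicator A (T x) * indicator B (T x - y) \<partial>lborel)
      = (\<integral>\<^sup>+x. indicator A (y + T x) * indicator B (T x) \<partial>lborel)" for y
  proof -
    obtain u where u: "T u = y"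
      using orthogonal_transformation_surj[OF T] by (metis surjD)
    have "(\<integral>\<^sup>+x. indicator A (T x) * indicator B (T x - y) \<partial>lborel)
       = (\<integral>\<^sup>+x. indicator A (T (u + x)) * indicator B (T (u + x) - y) \<partial>lborel)"
      by (subst nn_integral_lborel_translate) auto
    then show ?thesis by (simp add: linear_add[OF lin] u)
  qed
  have "emeasure (distr lborel borel T) A * emeasure lborel B
      = (\<integral>\<^sup>+x. indicator A (T x) * (\<integral>\<^sup>+y. indicator B y \<partial>lborel) \<partial>lborel)"
    by (simp add: nn_integral_multc nn_integral_distr flip: nn_integral_indicator)
  also have "\<dots> = (\<integral>\<^sup>+x. indicator A (T x) * (\<integral>\<^sup>+y. indicator B (T x - y) \<partial>lborel) \<partial>lborel)"
  proof (rule nn_integral_cong, rule arg_cong2[where f="(*)", OF refl])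
    fix x
    show "(\<integral>\<^sup>+y. indicator B y \<partial>lborel) = (\<integral>\<^sup>+y. indicator B (T x - y) \<partial>lborel)"
      using nn_integral_lborel_translate[of "indicator B" "- T x"]
      by (simp add: B_sym[of "T x"])
  qed
  also have "\<dots> = (\<integral>\<^sup>+x. \<integral>\<^sup>+y. indicator A (T x) * indicator B (T x - y) \<partial>lborel \<partial>lborel)"
    by (simp add: nn_integral_cmult)
  also have "\<dots> = (\<integral>\<^sup>+y. \<integral>\<^sup>+x. indicator A (T x) * indicator B (T x - y) \<partial>lborel \<partial>lborel)"
    by (rule lborel_pair.Fubini') measurable
  also have "\<dots> = (\<integral>\<^sup>+y. \<integral>\<^sup>+x. indicator A (y + T x) * indicator B (T x) \<partial>lborel \<partial>lborel)"
    by (simp add: translate)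
  also have "\<dots> = (\<integral>\<^sup>+x. \<integral>\<^sup>+y. indicator A (y + T x) * indicator B (T x) \<partial>lborel \<partial>lborel)"
    by (rule lborel_pair.Fubini'[symmetric]) measurable
  also have "\<dots> = (\<integral>\<^sup>+x. emeasure lborel A * indicator B x \<partial>lborel)"
    using nn_integral_lborel_translate[of "indicator A"]
    by (simp add: nn_integral_multc B_T add.commute[of _ "T _"])
  also have "\<dots> = emeasure lborel A * emeasure lborel B"
    by (simp add: nn_integral_cmult)
  finally have "emeasure lborel B * emeasure (distr lborel borel T) A
      = emeasure lborel B * emeasure lborel A"
    by (simp add: mult.commute)
  moreover have "emeasure lborel B \<noteq> \<infinity>" "emeasure lborel B \<noteq> 0"
    using emeasure_lborel_unit_ball by (auto simp: B_def)
  ultimately show "emeasure (distr lborel borel T) A = emeasure lborel A"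
    by (simp add: ennreal_mult_cancel_left)
qed simp

text \<open>The transformation is the reflection along \<open>x - y\<close>.\<close>

lemma orthogonal_transformation_between:
  fixes x y :: "'a::euclidean_space"
  assumes "norm x = norm y"
  obtains T where "orthogonal_transformation T" "T x = y"
proof (cases "x = y")
  case True
  then show ?thesis using that[of "\<lambda>x. x"] by simp
next
  case False
  define u where "u = x - y"
  have uu: "u \<bullet> u \<noteq> 0" using False by (simp add: u_def)
  have "x \<bullet> x = y \<bullet> y" using assms by (simp add: norm_eq)
  then have xu: "2 * (x \<bullet> u) = u \<bullet> u" by (simp add: u_def inner_diff inner_commute)
  define T where "T v = v - (2 * (v \<bullet> u) / (u \<bullet> u)) *\<^sub>R u" for v
  have "linear T"
    by (rule linearI) (simp_all add: T_def inner_add_left algebra_simps add_divide_distrib)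
  moreover have "T v \<bullet> T w = v \<bullet> w" for v w
    using uu by (simp add: T_def inner_diff inner_commute field_simps)
  moreover have "T x = y" using uu by (simp add: T_def xu) (simp add: u_def)
  ultimately show ?thesis using that[of T] by (simp add: orthogonal_transformation_def)
qed

section \<open>Surface measure on the sphere\<close>

lemma prob_space_uniform_ball: "prob_space (uniform_measure lborel (ball (0::'a::euclidean_space) 1))"
  by (intro prob_space_uniform_measure emeasure_lborel_unit_ball)

lemma sets_sphere_measure [simp, measurable_cong]: "sets sphere_measure = sets borel"
  and space_sphere_measure [simp]: "space sphere_measure = UNIV"
  by (simp_all add: sphere_measure_def)

lemma prob_space_sphere_measure: "prob_space (sphere_measure :: 'a::euclidean_space measure)"
  unfolding sphere_measure_def
  by (intro prob_space.prob_space_distr prob_space_uniform_ball) simp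

lemma AE_sphere_measure_norm: "AE \<Theta> in (sphere_measure :: 'a::euclidean_space measure). norm \<Theta> = 1"
proof -
  \<comment> \<open>Since \<open>inverse 0 = 0\<close>, the origin is the one point that radial
    projection does not send to the unit sphere.\<close>
  have "AE x in lborel. (x::'a) \<noteq> 0"
    by (rule AE_lborel_singleton)
  then have "AE x in uniform_measure lborel (ball (0::'a) 1). x \<noteq> 0"
    by (intro AE_uniform_measureI) auto
  then have "AE x in uniform_measure lborel (ball (0::'a) 1). norm (x /\<^sub>R norm x) = 1"
    by eventually_elim simp
  then show ?thesis
    unfolding sphere_measure_def by (subst AE_distr_iff) auto
qed

text \<open>\<open>T\<close> preserves Lebesgue measure and the unit ball, hence the uniform measure
  on it, and it commutes with radial projection.\<close>

lemma sphere_measure_distr_orthogonal: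
  fixes T :: "'a::euclidean_space \<Rightarrow> 'a"
  assumes T: "orthogonal_transformation T"
  shows "distr sphere_measure borel T = sphere_measure"
proof -
  let ?U = "uniform_measure lborel (ball (0::'a) 1)"
  have [measurable]: "T \<in> borel_measurable borel"
    by (rule orthogonal_transformation_measurable[OF T])
  have U: "distr ?U borel T = ?U"
  proof (rule measure_eqI)
    fix A assume "A \<in> sets (distr ?U borel T)"
    then have [measurable]: "A \<in> sets borel" by simp
    have "ball 0 1 \<inter> T -` A = T -` (ball 0 1 \<inter> A)"
      by (auto simp: orthogonal_transformation_norm[OF T])
    then have "emeasure lborel (ball 0 1 \<inter> T -` A) = emeasure (distr lborel borel T) (ball 0 1 \<inter> A)"
      by (simp add: emeasure_distr)
    then show "emeasure (distr ?U borel T) A = emeasure ?U A"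
      using measurable_sets[of T borel borel A]
      by (simp add: emeasure_distr lborel_distr_orthogonal[OF T])
  qed simp
  have "distr sphere_measure borel T = distr ?U borel (\<lambda>x. T (x /\<^sub>R norm x))"
    by (simp add: sphere_measure_def distr_distr comp_def)
  also have "\<dots> = distr (distr ?U borel T) borel (\<lambda>x. x /\<^sub>R norm x)"
    by (simp add: distr_distr comp_def orthogonal_transformation_scaleR[OF T] orthogonal_transformation_norm[OF T])
  also have "\<dots> = sphere_measure"
    by (simp only: U) (simp add: sphere_measure_def)
  finally show ?thesis .
qed

lemma integral_sphere_measure_uminus:
  fixes f :: "'a::euclidean_space \<Rightarrow> real"
  assumes [measurable]: "f \<in> borel_measurable borel"
  shows "(\<integral>\<Theta>. f (- \<Theta>) \<partial>sphere_measure) = (\<integral>\<Theta>. f \<Theta> \<partial>sphere_measure)"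
proof -
  have "orthogonal_transformation (\<lambda>x::'a. - x)"
    by (simp add: orthogonal_transformation_neg)
  from sphere_measure_distr_orthogonal[OF this] show ?thesis
    using integral_distr[of uminus sphere_measure borel f] by simp
qed

lemma integrable_sphere_measure_inner:
  "integrable sphere_measure (\<lambda>\<Theta>. \<bar>v \<bullet> \<Theta>\<bar>)"
proof -
  interpret prob_space "sphere_measure :: 'a measure" by (rule prob_space_sphere_measure)
  have "AE \<Theta> in sphere_measure. norm \<bar>v \<bullet> \<Theta>\<bar> \<le> norm v"
    using AE_sphere_measure_norm
    by eventually_elim (metis Cauchy_Schwarz_ineq2 mult.right_neutral real_norm_def abs_abs)
  then show ?thesis by (intro integrable_const_bound) auto
qed

text \<open>Rotation invariance makes the integral a function of \<open>norm v\<close> alone, and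
  homogeneity makes that function linear. This is how averaging over directions produces the kernel
  \<open>norm (x - y)\<close>.\<close>

lemma integral_sphere_measure_inner:
  obtains c :: real where "c > 0"
    "\<And>v::'a::euclidean_space. (\<integral>\<Theta>. \<bar>v \<bullet> \<Theta>\<bar> \<partial>sphere_measure) = c * norm v"
proof -
  interpret prob_space "sphere_measure :: 'a measure" by (rule prob_space_sphere_measure)
  define I where "I v = (\<integral>\<Theta>. \<bar>v \<bullet> \<Theta>\<bar> \<partial>sphere_measure)" for v :: 'a
  obtain e :: 'a where e: "e \<in> Basis" using nonempty_Basis by blast
  have I_orth: "I (T v) = I v" if T: "orthogonal_transformation T" for T v
  proof -
    have [measurable]: "T \<in> borel_measurable borel"
      by (rule orthogonal_transformation_measurable[OF T])
    have "I (T v) = (\<integral>\<Theta>. \<bar>T v \<bullet> \<Theta>\<bar> \<partial>distr sphere_measure borel T)"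
      by (simp add: I_def sphere_measure_distr_orthogonal[OF T])
    also have "\<dots> = (\<integral>\<Theta>. \<bar>T v \<bullet> T \<Theta>\<bar> \<partial>sphere_measure)"
      by (simp add: integral_distr)
    finally show ?thesis using T by (simp add: I_def orthogonal_transformation_def)
  qed
  have I_norm: "I v = I e * norm v" for v
  proof -
    have "norm (norm v *\<^sub>R e) = norm v" using e by simp
    then obtain T where T: "orthogonal_transformation T" "T (norm v *\<^sub>R e) = v"
      by (rule orthogonal_transformation_between)
    have "I v = I (norm v *\<^sub>R e)" using I_orth[OF T(1), of "norm v *\<^sub>R e"] T(2) by simp
    then show ?thesis by (simp add: I_def abs_mult)
  qed
  \<comment> \<open>Positivity of the constant: the \<open>l1\<close> norm of a unit vector is at
    least \<open>1\<close>, so the basis integrals, all equal to \<open>I e\<close>, cannot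
    vanish.\<close>
  have "1 = (\<integral>\<Theta>. (1::real) \<partial>(sphere_measure :: 'a measure))" using prob_space by simp
  also have "\<dots> \<le> (\<integral>\<Theta>. (\<Sum>b\<in>Basis. \<bar>b \<bullet> \<Theta>\<bar>) \<partial>(sphere_measure :: 'a measure))"
  proof (intro integral_mono_AE Bochner_Integration.integrable_sum integrable_sphere_measure_inner)
    show "AE \<Theta> in (sphere_measure :: 'a measure). 1 \<le> (\<Sum>b\<in>Basis. \<bar>b \<bullet> \<Theta>\<bar>)"
      using AE_sphere_measure_norm
    proof eventually_elim
      fix \<Theta> :: 'a assume "norm \<Theta> = 1"
      then show "1 \<le> (\<Sum>b\<in>Basis. \<bar>b \<bullet> \<Theta>\<bar>)"
        using norm_le_l1[of \<Theta>] by (simp add: inner_commute[of \<Theta>])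
    qed
  qed simp
  also have "\<dots> = (\<Sum>b\<in>Basis. I b)"
    by (simp add: I_def integral_sum integrable_sphere_measure_inner)
  also have "\<dots> = (\<Sum>b\<in>(Basis::'a set). I e)"
    using I_norm by (intro sum.cong refl) (metis mult.right_neutral norm_Basis)
  finally have "I e \<noteq> 0" by auto
  moreover have "I e \<ge> 0" by (simp add: I_def)
  ultimately show ?thesis
    by (intro that[of "I e"] I_norm[unfolded I_def, folded I_def[of e]]) simp
qed

section \<open>Energies of differences of probability measures\<close>

text \<open>The dominating function depends on \<open>w\<close> alone, so finiteness of
  \<open>Z\<close> yields joint integrability. It is applied with \<open>w\<close> running over
  half-spaces, tent centres and scales.\<close>

lemma dominated_Fubini:
  fixes F :: "'b \<Rightarrow> 'c \<Rightarrow> real"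
  assumes Z: "finite_measure Z" and M: "sigma_finite_measure M"
    and F [measurable]: "case_prod F \<in> borel_measurable (Z \<Otimes>\<^sub>M M)"
    and dom: "AE p in Z. \<forall>w\<in>space M. \<bar>F p w\<bar> \<le> h w"
    and h: "integrable M h"
  shows "integrable M (\<lambda>w. \<integral>p. F p w \<partial>Z)"
    and "(\<integral>p. (\<integral>w. F p w \<partial>M) \<partial>Z) = (\<integral>w. (\<integral>p. F p w \<partial>Z) \<partial>M)"
proof -
  interpret Z: finite_measure Z by (rule Z)
  interpret M: sigma_finite_measure M by (rule M)
  interpret ZM: pair_sigma_finite Z M ..
  have int: "AE p in Z. integrable M (F p)"
    using dom AE_space
  proof eventually_elim
    fix p assume *: "\<forall>w\<in>space M. \<bar>F p w\<bar> \<le> h w" and p: "p \<in> space Z"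
    have [measurable]: "F p \<in> borel_measurable M"
      using measurable_compose_Pair1[OF p F] by simp
    show "integrable M (F p)"
      using * by (intro Bochner_Integration.integrable_bound[OF h]) (auto intro!: AE_I2 order_trans[OF _ abs_ge_self])
  qed
  have "AE p in Z. norm (\<integral>w. norm (case_prod F (p, w)) \<partial>M) \<le> (\<integral>w. h w \<partial>M)"
    using dom int by eventually_elim (auto intro!: integral_mono h)
  then have "integrable (Z \<Otimes>\<^sub>M M) (case_prod F)"
    using int by (intro ZM.Fubini_integrable Z.integrable_const_bound) auto
  then show "integrable M (\<lambda>w. \<integral>p. F p w \<partial>Z)"
    and "(\<integral>p. (\<integral>w. F p w \<partial>M) \<partial>Z) = (\<integral>w. (\<integral>p. F p w \<partial>Z) \<partial>M)"
    by (auto intro: ZM.integrable_snd simp: ZM.Fubini_integral)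
qed

text \<open>Confinement to the ball is an almost-everywhere condition on a Borel measure of the
  whole space, so \<open>\<mu>\<close> and the empirical measure are handled alike and kernels
  bounded on the ball are integrable.\<close>

definition prob_on_ball :: "real \<Rightarrow> 'a::euclidean_space measure \<Rightarrow> bool" where
  "prob_on_ball R P \<longleftrightarrow> prob_space P \<and> sets P = sets borel \<and> (AE x in P. norm x < R)"

lemma prob_on_ball_pair:
  assumes P: "prob_on_ball R P" and Q: "prob_on_ball R Q"
  shows "prob_space (P \<Otimes>\<^sub>M Q)"
    and "sets (P \<Otimes>\<^sub>M Q) = sets (borel \<Otimes>\<^sub>M borel)"
    and "AE p in P \<Otimes>\<^sub>M Q. norm (fst p) < R \<and> norm (snd p) < R"
proof -
  interpret P: prob_space P using P by (simp add: prob_on_ball_def)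
  interpret Q: prob_space Q using Q by (simp add: prob_on_ball_def)
  interpret PQ: pair_sigma_finite P Q ..
  have [measurable_cong]: "sets P = sets borel" "sets Q = sets borel"
    using P Q by (auto simp: prob_on_ball_def)
  show "prob_space (P \<Otimes>\<^sub>M Q)" by (rule prob_space_pair) unfold_locales
  show "sets (P \<Otimes>\<^sub>M Q) = sets (borel \<Otimes>\<^sub>M borel)" by (intro sets_pair_measure_cong) fact+
  have "AE x in P. AE y in Q. norm (fst (x, y)) < R \<and> norm (snd (x, y)) < R"
    using P Q by (auto simp: prob_on_ball_def)
  then show "AE p in P \<Otimes>\<^sub>M Q. norm (fst p) < R \<and> norm (snd p) < R"
    by (intro PQ.AE_pair_measure) auto
qed

lemma prob_on_ball_pair_integrable:
  fixes K :: "'a::euclidean_space \<times> 'a \<Rightarrow> real"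
  assumes P: "prob_on_ball R P" and Q: "prob_on_ball R Q"
    and K: "K \<in> borel_measurable (borel \<Otimes>\<^sub>M borel)"
    and B: "\<And>x y. norm x < R \<Longrightarrow> norm y < R \<Longrightarrow> \<bar>K (x, y)\<bar> \<le> B"
  shows "integrable (P \<Otimes>\<^sub>M Q) K"
proof -
  interpret prob_space "P \<Otimes>\<^sub>M Q" by (rule prob_on_ball_pair[OF P Q])
  note [measurable_cong] = prob_on_ball_pair(2)[OF P Q]
  have "AE p in P \<Otimes>\<^sub>M Q. norm (K p) \<le> B"
    using prob_on_ball_pair(3)[OF P Q] by eventually_elim (use B in \<open>auto simp: split_beta\<close>)
  then show ?thesis using K by (intro integrable_const_bound) auto
qed

text \<open>The energy \<open>\<integral>\<integral> K(x, y) d\<nu>(x) d\<nu>(y)\<close> of the signed measure \<open>\<nu> = P - Q\<close>.\<close>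
definition energy :: "'a measure \<Rightarrow> 'a measure \<Rightarrow> ('a \<times> 'a \<Rightarrow> real) \<Rightarrow> real" where
  "energy P Q K = (\<integral>p. K p \<partial>(P \<Otimes>\<^sub>M P)) - (\<integral>p. K p \<partial>(P \<Otimes>\<^sub>M Q))
     - (\<integral>p. K p \<partial>(Q \<Otimes>\<^sub>M P)) + (\<integral>p. K p \<partial>(Q \<Otimes>\<^sub>M Q))"

context
  fixes R :: real and P Q :: "'a::euclidean_space measure"
  assumes P: "prob_on_ball R P" and Q: "prob_on_ball R Q"
begin

lemma energy_cong:
  assumes "K \<in> borel_measurable (borel \<Otimes>\<^sub>M borel)" "K' \<in> borel_measurable (borel \<Otimes>\<^sub>M borel)"
    and eq: "\<And>x y. norm x < R \<Longrightarrow> norm y < R \<Longrightarrow> K (x, y) = K' (x, y)"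
  shows "energy P Q K = energy P Q K'"
proof -
  have *: "(\<integral>p. K p \<partial>(A \<Otimes>\<^sub>M B)) = (\<integral>p. K' p \<partial>(A \<Otimes>\<^sub>M B))"
    if A: "prob_on_ball R A" and B: "prob_on_ball R B" for A B
  proof (rule integral_cong_AE)
    note [measurable_cong] = prob_on_ball_pair(2)[OF A B]
    show "K \<in> borel_measurable (A \<Otimes>\<^sub>M B)" "K' \<in> borel_measurable (A \<Otimes>\<^sub>M B)"
      using assms by auto
    show "AE p in A \<Otimes>\<^sub>M B. K p = K' p"
      using prob_on_ball_pair(3)[OF A B] by eventually_elim (use eq in \<open>auto simp: split_beta\<close>)
  qed
  show ?thesis by (simp add: energy_def * P Q)
qed

lemma energy_integral:
  fixes F :: "'a \<times> 'a \<Rightarrow> 'c \<Rightarrow> real"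
  assumes M: "sigma_finite_measure M"
    and F [measurable]: "case_prod F \<in> borel_measurable ((borel \<Otimes>\<^sub>M borel) \<Otimes>\<^sub>M M)"
    and dom: "\<And>x y w. norm x < R \<Longrightarrow> norm y < R \<Longrightarrow> \<bar>F (x, y) w\<bar> \<le> h w"
    and h: "integrable M h"
  shows "integrable M (\<lambda>w. energy P Q (\<lambda>p. F p w))"
    and "energy P Q (\<lambda>p. \<integral>w. F p w \<partial>M) = (\<integral>w. energy P Q (\<lambda>p. F p w) \<partial>M)"
proof -
  have *: "integrable M (\<lambda>w. \<integral>p. F p w \<partial>(A \<Otimes>\<^sub>M B))"
     "(\<integral>p. (\<integral>w. F p w \<partial>M) \<partial>(A \<Otimes>\<^sub>M B)) = (\<integral>w. (\<integral>p. F p w \<partial>(A \<Otimes>\<^sub>M B)) \<partial>M)"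
    if A: "prob_on_ball R A" and B: "prob_on_ball R B" for A B
  proof -
    note [measurable_cong] = prob_on_ball_pair(2)[OF A B]
    interpret prob_space "A \<Otimes>\<^sub>M B" by (rule prob_on_ball_pair[OF A B])
    have 1: "finite_measure (A \<Otimes>\<^sub>M B)" by unfold_locales
    have 2: "case_prod F \<in> borel_measurable ((A \<Otimes>\<^sub>M B) \<Otimes>\<^sub>M M)" by measurable
    have 3: "AE p in A \<Otimes>\<^sub>M B. \<forall>w\<in>space M. \<bar>F p w\<bar> \<le> h w"
      using prob_on_ball_pair(3)[OF A B] by eventually_elim (use dom in \<open>auto simp: split_beta\<close>)
    show "integrable M (\<lambda>w. \<integral>p. F p w \<partial>(A \<Otimes>\<^sub>M B))"
     "(\<integral>p. (\<integral>w. F p w \<partial>M) \<partial>(A \<Otimes>\<^sub>M B)) = (\<integral>w. (\<integral>p. F p w \<partial>(A \<Otimes>\<^sub>M B)) \<partial>M)"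
      by (rule dominated_Fubini[OF 1 M 2 3 h])+
  qed
  show "integrable M (\<lambda>w. energy P Q (\<lambda>p. F p w))"
    by (simp add: energy_def * P Q)
  show "energy P Q (\<lambda>p. \<integral>w. F p w \<partial>M) = (\<integral>w. energy P Q (\<lambda>p. F p w) \<partial>M)"
    by (simp add: energy_def * P Q)
qed

text \<open>On each of the four product measures the integral factors, and the energy is the
  expansion of a squared difference. Nonnegativity of energies always comes from here.\<close>

lemma energy_mult:
  fixes f :: "'a \<Rightarrow> real"
  assumes [measurable]: "f \<in> borel_measurable borel"
    and f: "\<And>x. norm x < R \<Longrightarrow> \<bar>f x\<bar> \<le> C"
  shows "energy P Q (\<lambda>p. f (fst p) * f (snd p)) = ((\<integral>x. f x \<partial>P) - (\<integral>x. f x \<partial>Q))\<^sup>2"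
proof -
  have *: "(\<integral>p. f (fst p) * f (snd p) \<partial>(A \<Otimes>\<^sub>M B)) = (\<integral>x. f x \<partial>A) * (\<integral>x. f x \<partial>B)"
    if A: "prob_on_ball R A" and B: "prob_on_ball R B" for A B
  proof -
    interpret A: prob_space A using A by (simp add: prob_on_ball_def)
    interpret B: prob_space B using B by (simp add: prob_on_ball_def)
    interpret AB: pair_sigma_finite A B ..
    have "integrable (A \<Otimes>\<^sub>M B) (\<lambda>p. f (fst p) * f (snd p))"
      by (rule prob_on_ball_pair_integrable[OF A B, where B="C * C"])
        (auto simp: abs_mult intro!: mult_mono f intro: order_trans[OF abs_ge_zero f])
    from AB.integral_fst'[OF this] show ?thesis by simp
  qed
  show ?thesis by (simp add: energy_def * P Q power2_eq_square algebra_simps)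
qed

text \<open>\<open>P\<close> and \<open>Q\<close> have the same total mass, so each one-variable
  integral occurs once with either sign among the four terms and cancels.\<close>

lemma energy_affine:
  fixes K :: "'a \<times> 'a \<Rightarrow> real" and a b :: "'a \<Rightarrow> real"
  assumes [measurable]: "K \<in> borel_measurable (borel \<Otimes>\<^sub>M borel)"
      "a \<in> borel_measurable borel" "b \<in> borel_measurable borel"
    and bounds: "\<And>x y. norm x < R \<Longrightarrow> norm y < R \<Longrightarrow> \<bar>K (x, y)\<bar> \<le> C"
      "\<And>x. norm x < R \<Longrightarrow> \<bar>a x\<bar> \<le> C" "\<And>x. norm x < R \<Longrightarrow> \<bar>b x\<bar> \<le> C"
  shows "energy P Q (\<lambda>p. a (fst p) + b (snd p) + t * K p) = t * energy P Q K"
proof -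
  have *: "(\<integral>p. a (fst p) + b (snd p) + t * K p \<partial>(A \<Otimes>\<^sub>M B))
      = (\<integral>x. a x \<partial>A) + (\<integral>y. b y \<partial>B) + t * (\<integral>p. K p \<partial>(A \<Otimes>\<^sub>M B))"
    if A: "prob_on_ball R A" and B: "prob_on_ball R B" for A B
  proof -
    interpret A: prob_space A using A by (simp add: prob_on_ball_def)
    interpret B: prob_space B using B by (simp add: prob_on_ball_def)
    interpret AB: pair_sigma_finite A B ..
    have i: "integrable (A \<Otimes>\<^sub>M B) (\<lambda>p. a (fst p))" "integrable (A \<Otimes>\<^sub>M B) (\<lambda>p. b (snd p))"
      "integrable (A \<Otimes>\<^sub>M B) K"
      by (rule prob_on_ball_pair_integrable[OF A B, where B="C"]; auto intro: bounds)+
    show ?thesis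
      using AB.integral_fst'[OF i(1)] AB.integral_fst'[OF i(2)] i
      by (simp add: A.prob_space B.prob_space)
  qed
  show ?thesis
    unfolding energy_def *[OF P P] *[OF P Q] *[OF Q P] *[OF Q Q] by (simp add: algebra_simps)
qed

end

section \<open>Half-space discrepancy as an energy\<close>

text \<open>Both sides are the smaller of \<open>\<bar>a\<bar>\<close> and
  \<open>\<bar>b\<bar>\<close> when the signs agree, and \<open>0\<close> when they differ. It turns
  the lengths of \<open>\<rho>\<close>-intervals for \<open>\<Theta>\<close> and
  \<open>-\<Theta>\<close> into absolute values.\<close>

lemma max_min_symmetrization:
  fixes a b :: real
  shows "max 0 (min a b) + max 0 (min (- a) (- b)) = (\<bar>a\<bar> + \<bar>b\<bar> - \<bar>a - b\<bar>) / 2"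
  by (auto simp: max_def min_def abs_if)

text \<open>For unit \<open>\<Theta>\<close> a half-space with \<open>\<rho> \<ge> R\<close> misses
  the ball of radius \<open>R\<close>, so a slab of finite measure can serve as dominating
  function.\<close>

lemma integrable_slab:
  "integrable (lborel \<Otimes>\<^sub>M sphere_measure)
     (\<lambda>w::real \<times> 'a::euclidean_space. indicator ({0<..<R} \<times> UNIV) w :: real)"
proof -
  interpret S: prob_space "sphere_measure :: 'a measure" by (rule prob_space_sphere_measure)
  have "emeasure lborel {0<..<R} < \<infinity>" by (cases "0 \<le> R") auto
  then show ?thesis
    using S.emeasure_space_1 by (intro integrable_real_indicator) (auto simp: S.emeasure_pair_measure_Times)
qed

text \<open>For fixed \<open>\<Theta>\<close> the admissible \<open>\<rho>\<close> form the interval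
  from \<open>0\<close> to the smaller of the two inner products, of length
  \<open>m \<Theta>\<close>. Averaging \<open>m\<close> over \<open>\<Theta>\<close> and
  \<open>-\<Theta>\<close> leaves integrals of absolute values only.\<close>

lemma integral_common_halfspaces:
  fixes x y :: "'a::euclidean_space"
  assumes c: "\<And>v::'a. (\<integral>\<Theta>. \<bar>v \<bullet> \<Theta>\<bar> \<partial>sphere_measure) = c * norm v"
    and xR: "norm x < R"
  shows "(\<integral>w. indicator {0<..<R} (fst w) * indicator (halfspace (fst w) (snd w)) x
             * indicator (halfspace (fst w) (snd w)) y \<partial>(lborel \<Otimes>\<^sub>M sphere_measure))
       = c / 4 * (norm x + norm y - norm (x - y))" (is "integral\<^sup>L _ ?F = _")
proof -
  interpret S: prob_space "sphere_measure :: 'a measure" by (rule prob_space_sphere_measure)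
  interpret LS: pair_sigma_finite lborel "sphere_measure :: 'a measure" ..
  have F_eq: "?F = (\<lambda>w. indicator {0<..<R} (fst w) * (if fst w < x \<bullet> snd w then 1 else 0)
       * (if fst w < y \<bullet> snd w then 1 else 0))"
    by (auto simp: fun_eq_iff halfspace_def indicator_def)
  have F_meas [measurable]: "?F \<in> borel_measurable (lborel \<Otimes>\<^sub>M sphere_measure)"
    unfolding F_eq by measurable
  have F_int: "integrable (lborel \<Otimes>\<^sub>M sphere_measure) ?F"
    by (rule Bochner_Integration.integrable_bound[OF integrable_slab[of R] F_meas]) (auto simp: indicator_def)
  define m where "m \<Theta> = max 0 (min (x \<bullet> \<Theta>) (y \<bullet> \<Theta>))" for \<Theta>
  have m_meas [measurable]: "m \<in> borel_measurable borel"
    unfolding m_def[abs_def] by measurable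
  have m_int: "integrable sphere_measure m"
    by (rule Bochner_Integration.integrable_bound[OF integrable_sphere_measure_inner[of x]])
      (auto simp: m_def)
  have "AE \<Theta> in sphere_measure. (\<integral>\<rho>. ?F (\<rho>, \<Theta>) \<partial>lborel) = m \<Theta>"
    using AE_sphere_measure_norm
  proof eventually_elim
    fix \<Theta> :: 'a assume "norm \<Theta> = 1"
    \<comment> \<open>By Cauchy-Schwarz the cut-off at \<open>R\<close> does not shorten the
      interval.\<close>
    then have "x \<bullet> \<Theta> < R" using xR norm_cauchy_schwarz[of x \<Theta>] by simp
    then have "(\<lambda>\<rho>. ?F (\<rho>, \<Theta>)) = indicator {0<..<min (x \<bullet> \<Theta>) (y \<bullet> \<Theta>)}"
      by (auto simp: fun_eq_iff halfspace_def indicator_def)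
    moreover have "measure lborel {0<..<t} = max 0 t" for t :: real
      by (cases "0 \<le> t") auto
    ultimately show "(\<integral>\<rho>. ?F (\<rho>, \<Theta>) \<partial>lborel) = m \<Theta>"
      by (simp add: m_def)
  qed
  moreover have "integrable sphere_measure (\<lambda>\<Theta>. \<integral>\<rho>. ?F (\<rho>, \<Theta>) \<partial>lborel)"
    using LS.integrable_snd[of "\<lambda>\<rho> \<Theta>. ?F (\<rho>, \<Theta>)"] F_int by (simp add: split_beta')
  moreover have "(\<integral>\<Theta>. \<integral>\<rho>. ?F (\<rho>, \<Theta>) \<partial>lborel \<partial>sphere_measure) = integral\<^sup>L (lborel \<Otimes>\<^sub>M sphere_measure) ?F"
    using LS.integral_snd[of "\<lambda>\<rho> \<Theta>. ?F (\<rho>, \<Theta>)"] F_int by (simp add: split_beta')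
  ultimately have "integral\<^sup>L (lborel \<Otimes>\<^sub>M sphere_measure) ?F = (\<integral>\<Theta>. m \<Theta> \<partial>sphere_measure)"
    using m_int integral_cong_AE[of "\<lambda>\<Theta>. \<integral>\<rho>. ?F (\<rho>, \<Theta>) \<partial>lborel" sphere_measure m]
    by (metis (no_types, lifting) borel_measurable_integrable)
  also have "\<dots> = ((\<integral>\<Theta>. m \<Theta> \<partial>sphere_measure) + (\<integral>\<Theta>. m (- \<Theta>) \<partial>sphere_measure)) / 2"
    by (subst integral_sphere_measure_uminus) (auto simp: m_def)
  also have "\<dots> = (\<integral>\<Theta>. m \<Theta> + m (- \<Theta>) \<partial>sphere_measure) / 2"
  proof -
    have "integrable sphere_measure (\<lambda>\<Theta>. m (- \<Theta>))"
      by (rule Bochner_Integration.integrable_bound[OF integrable_sphere_measure_inner[of x]])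
        (auto simp: m_def)
    then show ?thesis using m_int by simp
  qed
  also have "\<dots> = (\<integral>\<Theta>. (\<bar>x \<bullet> \<Theta>\<bar> + \<bar>y \<bullet> \<Theta>\<bar> - \<bar>(x - y) \<bullet> \<Theta>\<bar>) / 2 \<partial>sphere_measure) / 2"
    unfolding m_def inner_minus_right max_min_symmetrization by (simp add: inner_diff_left)
  also have "\<dots> = c / 4 * (norm x + norm y - norm (x - y))"
    by (simp add: integrable_sphere_measure_inner c right_diff_distrib distrib_left del: inner_diff_left)
  finally show ?thesis .
qed

text \<open>For a fixed half-space the squared difference of masses is the energy of a product of
  indicators; exchanging energy and integration over the slab gives \<open>S\<close>. The factor
  \<open>k\<close> will be the number of points.\<close>

lemma halfspace_discrepancy_energy:
  fixes P Q :: "'a::euclidean_space measure"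
  assumes P: "prob_on_ball R P" and Q: "prob_on_ball R Q"
    and c: "\<And>v::'a. (\<integral>\<Theta>. \<bar>v \<bullet> \<Theta>\<bar> \<partial>sphere_measure) = c * norm v"
  defines "S \<equiv> - (c / 4) * energy P Q (\<lambda>p. norm (fst p - snd p))"
  shows "0 \<le> S"
    and "ennreal (k\<^sup>2 * S) \<le> (\<integral>\<^sup>+\<rho>\<in>{0<..}. (\<integral>\<^sup>+\<Theta>. ennreal ((k * (measure P (halfspace \<rho> \<Theta>)
           - measure Q (halfspace \<rho> \<Theta>)))\<^sup>2) \<partial>sphere_measure) \<partial>lborel)"
proof -
  interpret S: prob_space "sphere_measure :: 'a measure" by (rule prob_space_sphere_measure)
  interpret LS: pair_sigma_finite lborel "sphere_measure :: 'a measure" ..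
  let ?M = "lborel \<Otimes>\<^sub>M (sphere_measure :: 'a measure)"
  define \<phi> :: "real \<times> 'a \<Rightarrow> 'a \<Rightarrow> real" where
    "\<phi> w x = indicator {0<..<R} (fst w) * indicator (halfspace (fst w) (snd w)) x" for w x
  define F where "F p w = \<phi> w (fst p) * \<phi> w (snd p)" for p :: "'a \<times> 'a" and w
  define D where "D \<rho> \<Theta> = (measure P (halfspace \<rho> \<Theta>) - measure Q (halfspace \<rho> \<Theta>))\<^sup>2" for \<rho> \<Theta>
  have M: "sigma_finite_measure ?M" by unfold_locales
  \<comment> \<open>The explicit conditional makes measurability jointly in point and half-space
    accessible.\<close>
  have \<phi>_eq: "\<phi> w x = (if 0 < fst w \<and> fst w < R \<and> fst w < x \<bullet> snd w then 1 else 0)" for w x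
    by (simp add: \<phi>_def halfspace_def indicator_def)
  have halfspace_sets [measurable]: "halfspace \<rho> \<Theta> \<in> sets borel" for \<rho> and \<Theta> :: 'a
    unfolding halfspace_def by measurable
  have F_meas: "case_prod F \<in> borel_measurable ((borel \<Otimes>\<^sub>M borel) \<Otimes>\<^sub>M ?M)"
    unfolding F_def \<phi>_eq by measurable
  have dom: "\<bar>F (x, y) w\<bar> \<le> indicator ({0<..<R} \<times> UNIV) w" for x y w
    by (cases w) (auto simp: F_def \<phi>_eq indicator_def)
  have h: "integrable ?M (\<lambda>w. indicator ({0<..<R} \<times> UNIV) w :: real)"
    by (rule integrable_slab)
  have energy_F: "energy P Q (\<lambda>p. F p w) = indicator {0<..<R} (fst w) * D (fst w) (snd w)" for w
  proof -
    have "(\<integral>x. \<phi> w x \<partial>A) = indicator {0<..<R} (fst w) * measure A (halfspace (fst w) (snd w))"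
      if "prob_on_ball R A" for A
      using that sets_eq_imp_space_eq[of A borel] by (simp add: \<phi>_def prob_on_ball_def)
    moreover have "\<phi> w \<in> borel_measurable borel" unfolding \<phi>_def by measurable
    ultimately show ?thesis
      unfolding F_def using energy_mult[OF P Q, of "\<phi> w" 1] P Q
      by (auto simp: D_def \<phi>_eq power2_eq_square indicator_def)
  qed
  \<comment> \<open>Integrating the indicators gives \<open>c / 4\<close> times
    \<open>norm x + norm y - norm (x - y)\<close>, and the first two terms have zero energy.\<close>
  have "S = energy P Q (\<lambda>p. \<integral>w. F p w \<partial>?M)"
  proof -
    have "energy P Q (\<lambda>p. \<integral>w. F p w \<partial>?M)
      = energy P Q (\<lambda>p. c / 4 * norm (fst p) + c / 4 * norm (snd p) + - (c / 4) * norm (fst p - snd p))"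
    proof (rule energy_cong[OF P Q])
      show "(\<lambda>p. \<integral>w. F p w \<partial>?M) \<in> borel_measurable (borel \<Otimes>\<^sub>M borel)"
        using F_meas by measurable
      fix x y :: 'a assume "norm x < R"
      moreover have "F (x, y) w = indicator {0<..<R} (fst w) * indicator (halfspace (fst w) (snd w)) x
             * indicator (halfspace (fst w) (snd w)) y" for w
        by (simp add: F_def \<phi>_def indicator_def)
      ultimately show "(\<integral>w. F (x, y) w \<partial>?M)
         = c / 4 * norm (fst (x, y)) + c / 4 * norm (snd (x, y)) + - (c / 4) * norm (fst (x, y) - snd (x, y))"
        using integral_common_halfspaces[OF c, of x R y] by (simp add: algebra_simps)
    qed measurable
    also have "\<dots> = S"
      unfolding S_def
    proof (rule energy_affine[OF P Q, where C="\<bar>c\<bar> * \<bar>R\<bar> + 2 * \<bar>R\<bar>"])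
      fix x y :: 'a assume x: "norm x < R"
      have "\<bar>c / 4\<bar> * norm x \<le> \<bar>c\<bar> * \<bar>R\<bar>" using x by (intro mult_mono) auto
      then show "\<bar>c / 4 * norm x\<bar> \<le> \<bar>c\<bar> * \<bar>R\<bar> + 2 * \<bar>R\<bar>"
          "\<bar>c / 4 * norm x\<bar> \<le> \<bar>c\<bar> * \<bar>R\<bar> + 2 * \<bar>R\<bar>"
        by (simp_all add: abs_mult)
      assume "norm y < R"
      then have "norm (x - y) \<le> 2 * \<bar>R\<bar>" using x norm_triangle_ineq4[of x y] by simp
      then show "\<bar>norm (fst (x, y) - snd (x, y))\<bar> \<le> \<bar>c\<bar> * \<bar>R\<bar> + 2 * \<bar>R\<bar>"
        by (simp add: add_increasing)
    qed measurable
    finally show ?thesis by simp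
  qed
  also have "\<dots> = (\<integral>w. indicator {0<..<R} (fst w) * D (fst w) (snd w) \<partial>?M)"
    using energy_integral(2)[OF P Q M F_meas dom h] by (simp add: energy_F)
  finally have S_eq: "S = (\<integral>w. indicator {0<..<R} (fst w) * D (fst w) (snd w) \<partial>?M)" .
  have int: "integrable ?M (\<lambda>w. indicator {0<..<R} (fst w) * D (fst w) (snd w))"
    using energy_integral(1)[OF P Q M F_meas dom h] by (simp add: energy_F)
  show "0 \<le> S" by (simp add: S_eq D_def)
  let ?G = "\<lambda>w. indicator {0<..<R} (fst w) * (k\<^sup>2 * D (fst w) (snd w))"
  have G_int: "integrable ?M ?G" and G: "k\<^sup>2 * S = (\<integral>w. ?G w \<partial>?M)"
    using integrable_mult_right[OF int, of "k\<^sup>2"] integral_mult_right_zero[of ?M "k\<^sup>2"]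
    by (simp_all add: S_eq mult.left_commute)
  have "ennreal (k\<^sup>2 * S) = (\<integral>\<^sup>+w. ennreal (?G w) \<partial>?M)"
    unfolding G by (subst nn_integral_eq_integral[OF G_int]) (auto simp: D_def)
  also have "\<dots> = (\<integral>\<^sup>+\<rho>. \<integral>\<^sup>+\<Theta>. ennreal (indicator {0<..<R} \<rho> * (k\<^sup>2 * D \<rho> \<Theta>)) \<partial>sphere_measure \<partial>lborel)"
    using borel_measurable_integrable[OF G_int] by (subst S.nn_integral_fst[symmetric]) auto
  \<comment> \<open>Removing the cut-off \<open>\<rho> < R\<close> can only enlarge the integral of
    a nonnegative function.\<close>
  also have "\<dots> \<le> (\<integral>\<^sup>+\<rho>\<in>{0<..}. (\<integral>\<^sup>+\<Theta>. ennreal (k\<^sup>2 * D \<rho> \<Theta>) \<partial>sphere_measure) \<partial>lborel)"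
    by (intro nn_integral_mono) (auto simp: indicator_def)
  finally show "ennreal (k\<^sup>2 * S) \<le> (\<integral>\<^sup>+\<rho>\<in>{0<..}. (\<integral>\<^sup>+\<Theta>. ennreal ((k * (measure P (halfspace \<rho> \<Theta>)
           - measure Q (halfspace \<rho> \<Theta>)))\<^sup>2) \<partial>sphere_measure) \<partial>lborel)"
    by (simp add: D_def power_mult_distrib)
qed

section \<open>Autocorrelation of the tent function\<close>

text \<open>The Lipschitz profile matters: for the indicator of a ball the autocorrelation drops
  linearly at \<open>0\<close>, and the integral over scales \<open>t\<close> would diverge like
  that of \<open>1/t\<close> at infinity.\<close>

definition tent :: "'a::euclidean_space \<Rightarrow> real" where
  "tent w = max 0 (1 - norm w)"

definition tent_corr :: "'a::euclidean_space \<Rightarrow> real" where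
  "tent_corr u = (\<integral>w. tent w * tent (w - u) \<partial>lborel)"

lemma tent_measurable [measurable]: "tent \<in> borel_measurable borel"
  unfolding tent_def[abs_def] by measurable

lemma tent_bounds: "0 \<le> tent w" "tent w \<le> 1"
  by (auto simp: tent_def)

lemma tent_eq_0: "1 \<le> norm w \<Longrightarrow> tent w = 0"
  by (simp add: tent_def)

lemma tent_lipschitz: "\<bar>tent u - tent w\<bar> \<le> norm (u - w)"
  using norm_triangle_ineq3[of u w] by (simp add: tent_def)

lemma integrable_indicator_cball: "integrable lborel (indicator (cball (a::'a::euclidean_space) r) :: 'a \<Rightarrow> real)"
  using emeasure_lborel_cball_finite[of a r] by (intro integrable_real_indicator) auto

lemma integrable_tent_mult:
  assumes [measurable]: "f \<in> borel_measurable borel" and f: "\<And>w::'a::euclidean_space. \<bar>f w\<bar> \<le> 1"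
  shows "integrable lborel (\<lambda>w. tent (w - a) * f w)"
proof (rule Bochner_Integration.integrable_bound[OF integrable_indicator_cball[of a 1]])
  have "\<bar>tent (w - a) * f w\<bar> \<le> indicator (cball a 1) w" for w
  proof (cases "1 \<le> norm (w - a)")
    case False
    then show ?thesis
      using tent_bounds[of "w - a"] f[of w] mult_mono[of "tent (w - a)" 1 "\<bar>f w\<bar>" 1]
      by (simp add: abs_mult dist_norm norm_minus_commute)
  qed (simp add: tent_eq_0)
  then show "AE w in lborel. norm (tent (w - a) * f w) \<le> norm (indicator (cball a 1) w :: real)"
    by simp
qed measurable

lemma integrable_tent_tent: "integrable lborel (\<lambda>w. tent (w - a) * tent (w - b))"
  by (rule integrable_tent_mult) (auto simp: tent_bounds)

lemma tent_corr_measurable [measurable]: "tent_corr \<in> borel_measurable borel"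
  unfolding tent_corr_def[abs_def] by measurable

text \<open>Reading the integral as a superposition of products of one function at \<open>a\<close>
  and at \<open>b\<close> is what makes the kernel positive semidefinite.\<close>

lemma tent_corr_translate:
  "(\<integral>w. tent (w - a) * tent (w - b) \<partial>lborel) = tent_corr (a - b)"
proof -
  have "(\<integral>w. tent (w - a) * tent (w - b) \<partial>lborel) = (\<integral>w. tent ((b + w) - a) * tent ((b + w) - b) \<partial>lborel)"
    by (rule integral_lborel_translate[symmetric]) measurable
  then show ?thesis by (simp add: tent_corr_def algebra_simps)
qed

lemma tent_corr_nonneg: "0 \<le> tent_corr u"
  unfolding tent_corr_def by (simp add: tent_bounds)

lemma tent_corr_orthogonal:
  fixes T :: "'a::euclidean_space \<Rightarrow> 'a"
  assumes T: "orthogonal_transformation T"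
  shows "tent_corr (T u) = tent_corr u"
proof -
  have [measurable]: "T \<in> borel_measurable borel"
    by (rule orthogonal_transformation_measurable[OF T])
  have "tent_corr (T u) = (\<integral>w. tent w * tent (w - T u) \<partial>distr lborel borel T)"
    by (simp add: tent_corr_def lborel_distr_orthogonal[OF T])
  also have "\<dots> = (\<integral>w. tent (T w) * tent (T w - T u) \<partial>lborel)"
    by (simp add: integral_distr)
  also have "\<dots> = (\<integral>w. tent w * tent (w - u) \<partial>lborel)"
    unfolding linear_diff[OF orthogonal_transformation_linear[OF T], symmetric]
    by (simp add: tent_def orthogonal_transformation_norm[OF T])
  finally show ?thesis by (simp add: tent_corr_def)
qed

lemma tent_corr_radial:
  fixes u v :: "'a::euclidean_space"
  shows "norm u = norm v \<Longrightarrow> tent_corr u = tent_corr v"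
  by (erule orthogonal_transformation_between) (auto simp: tent_corr_orthogonal)

lemma tent_corr_eq_0: "2 \<le> norm u \<Longrightarrow> tent_corr u = 0"
proof -
  assume u: "2 \<le> norm u"
  have "tent w * tent (w - u) = 0" for w
    using tent_eq_0[of w] tent_eq_0[of "w - u"] norm_triangle_ineq4[of w "w - u"] u
    by (cases "1 \<le> norm w") auto
  then show ?thesis unfolding tent_corr_def by (simp only: Bochner_Integration.integral_zero)
qed

text \<open>Expand the square; by translation invariance both pure squares integrate to
  \<open>tent_corr 0\<close>. Maximality at \<open>0\<close> and the quadratic bound both
  follow.\<close>

lemma tent_corr_diff:
  fixes u :: "'a::euclidean_space"
  shows "tent_corr (0::'a) - tent_corr u = (\<integral>w. (tent w - tent (w - u))\<^sup>2 \<partial>lborel) / 2"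
proof -
  have i: "integrable lborel (\<lambda>w::'a. tent w * tent w)" "integrable lborel (\<lambda>w. tent w * tent (w - u))"
      "integrable lborel (\<lambda>w. tent (w - u) * tent (w - u))"
    using integrable_tent_tent[of "0::'a" 0] integrable_tent_tent[of 0 u] integrable_tent_tent[of u u] by simp_all
  have "(\<integral>w. (tent w - tent (w - u))\<^sup>2 \<partial>lborel)
      = (\<integral>w. tent w * tent w + tent (w - u) * tent (w - u) - 2 * (tent w * tent (w - u)) \<partial>lborel)"
    by (intro Bochner_Integration.integral_cong) (simp_all add: power2_eq_square algebra_simps)
  also have "\<dots> = (\<integral>w. tent w * tent (w::'a) \<partial>lborel) + (\<integral>w. tent (w - u) * tent (w - u) \<partial>lborel)
      - 2 * tent_corr u"
    by (simp add: i tent_corr_def)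
  also have "\<dots> = 2 * (tent_corr (0::'a) - tent_corr u)"
    using tent_corr_translate[of "0::'a" 0] tent_corr_translate[of u u] by simp
  finally show ?thesis by simp
qed

lemma tent_corr_le:
  fixes u :: "'a::euclidean_space"
  shows "tent_corr u \<le> tent_corr (0::'a)"
  using tent_corr_diff[of u] Bochner_Integration.integral_nonneg[of lborel "\<lambda>w. (tent w - tent (w - u))\<^sup>2"]
  by (simp del: Bochner_Integration.integral_nonneg)

text \<open>The integrand is at most the square of \<open>norm u\<close> by the Lipschitz bound and
  lives on two unit balls; the two volumes cancel the factor \<open>1/2\<close>.\<close>

lemma tent_corr_diff_le:
  fixes u :: "'a::euclidean_space"
  shows "tent_corr (0::'a) - tent_corr u \<le> measure lborel (cball (0::'a) 1) * (norm u)\<^sup>2"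
proof -
  let ?V = "measure lborel (cball (0::'a) 1)"
  let ?I = "\<lambda>w. (norm u)\<^sup>2 * (indicator (cball 0 1) w + indicator (cball u 1) w) :: real"
  have V: "measure lborel (cball u 1) = ?V"
    by (simp add: content_cball)
  have "(tent w - tent (w - u))\<^sup>2 \<le> ?I w" for w
  proof (cases "w \<in> cball 0 1 \<or> w \<in> cball u 1")
    case True
    have "(tent w - tent (w - u))\<^sup>2 \<le> (norm u)\<^sup>2 * 1"
      using tent_lipschitz[of w "w - u"] by (simp add: abs_le_square_iff[symmetric])
    also have "\<dots> \<le> ?I w"
      using True by (intro mult_left_mono) (auto simp: indicator_def)
    finally show ?thesis .
  next
    case False
    then show ?thesis
      by (simp add: tent_eq_0 dist_norm norm_minus_commute)
  qed
  then have "(\<integral>w. (tent w - tent (w - u))\<^sup>2 \<partial>lborel) \<le> (\<integral>w. ?I w \<partial>lborel)"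
    using integrable_indicator_cball[of "0::'a" 1] integrable_indicator_cball[of u 1]
    by (intro integral_mono' integrable_mult_right Bochner_Integration.integrable_add) auto
  also have "\<dots> = 2 * ?V * (norm u)\<^sup>2"
    using integrable_indicator_cball[of "0::'a" 1] integrable_indicator_cball[of u 1]
    by (simp add: V)
  finally show ?thesis by (simp add: tent_corr_diff)
qed

lemma tent_corr_0_pos: "0 < tent_corr (0::'a::euclidean_space)"
proof -
  \<comment> \<open>On the ball of radius \<open>1/2\<close> the tent is at least
    \<open>1/2\<close>, so its square is at least \<open>1/4\<close>.\<close>
  have "0 < measure lborel (ball (0::'a) (1/2)) / 4"
    by (simp add: content_ball_pos)
  also have "\<dots> = (\<integral>w. indicator (ball (0::'a) (1/2)) w / 4 \<partial>lborel)"
    by simp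
  also have "\<dots> \<le> (\<integral>w. tent (w - 0) * tent (w - 0::'a) \<partial>lborel)"
  proof (rule integral_mono')
    fix w :: 'a
    show "indicator (ball (0::'a) (1/2)) w / 4 \<le> tent (w - 0) * tent (w - 0)"
      using mult_mono[of "1/2" "tent w" "1/2" "tent w"] tent_bounds[of w]
      by (auto simp: indicator_def tent_def)
  qed (use integrable_tent_tent[of "0::'a" 0] in \<open>auto simp: tent_bounds\<close>)
  finally show ?thesis by (simp add: tent_corr_def)
qed

section \<open>Integrating the loss of autocorrelation over all scales\<close>

definition tent_deficit :: "real \<Rightarrow> 'a::euclidean_space \<Rightarrow> real" where
  "tent_deficit t v = indicator {0<..} t * (tent_corr (0::'a) - tent_corr (v /\<^sub>R t))"

text \<open>Substitute \<open>t = norm v * s\<close>: since \<open>tent_corr\<close> is radial, the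
  integrand becomes the one for a unit vector \<open>e\<close>, and the Jacobian is
  \<open>norm v\<close>.\<close>

lemma tent_deficit_integral:
  obtains C :: real where
    "\<And>v::'a::euclidean_space. (\<integral>t. tent_deficit t v \<partial>lborel) = C * norm v"
proof -
  obtain e :: 'a where e: "e \<in> Basis" using nonempty_Basis by blast
  have "(\<integral>t. tent_deficit t v \<partial>lborel) = (\<integral>t. tent_deficit t e \<partial>lborel) * norm v" for v :: 'a
  proof (cases "v = 0")
    case True
    then show ?thesis by (simp add: tent_deficit_def)
  next
    case False
    have scale: "tent_deficit (0 + norm v * s) v = tent_deficit s e" for s
    proof (cases "s > 0")
      case True
      then have "tent_corr (v /\<^sub>R (norm v * s)) = tent_corr (e /\<^sub>R s)"
        using False e by (intro tent_corr_radial) (simp add: field_simps)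
      with True False show ?thesis by (simp add: tent_deficit_def)
    qed (use False in \<open>simp add: tent_deficit_def zero_less_mult_iff\<close>)
    show ?thesis
      using lborel_integral_real_affine[of "norm v" "\<lambda>t. tent_deficit t v" 0] False
      by (simp only: scale) simp
  qed
  then show ?thesis by (rule that)
qed

text \<open>The trivial bound \<open>tent_corr 0\<close> serves small \<open>t\<close>, the
  quadratic bound large \<open>t\<close>. Adding the estimates for \<open>\<delta>\<close> and
  \<open>\<delta> * t\<^sup>2\<close> merges them into one integrable majorant.\<close>

lemma tent_deficit_bound:
  assumes "norm (v::'a::euclidean_space) \<le> B"
  shows "\<bar>tent_deficit t v\<bar>
    \<le> (tent_corr (0::'a) + measure lborel (cball (0::'a) 1) * B\<^sup>2) * (indicator {0<..} t * inverse (1 + t\<^sup>2))"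
proof (cases "t > 0")
  case True
  define \<delta> where "\<delta> = tent_corr (0::'a) - tent_corr (v /\<^sub>R t)"
  have "\<delta> \<ge> 0" "\<delta> \<le> tent_corr (0::'a)"
    using tent_corr_le[of "v /\<^sub>R t"] tent_corr_nonneg[of "v /\<^sub>R t"] by (auto simp: \<delta>_def)
  have "\<delta> * t\<^sup>2 \<le> measure lborel (cball (0::'a) 1) * (norm (v /\<^sub>R t))\<^sup>2 * t\<^sup>2"
    unfolding \<delta>_def by (intro mult_right_mono tent_corr_diff_le) simp
  also have "\<dots> = measure lborel (cball (0::'a) 1) * (norm v)\<^sup>2"
    using True by (simp add: field_simps power2_eq_square)
  also have "\<dots> \<le> measure lborel (cball (0::'a) 1) * B\<^sup>2"
    using assms by (intro mult_left_mono power_mono) auto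
  finally have "\<delta> * (1 + t\<^sup>2) \<le> tent_corr (0::'a) + measure lborel (cball (0::'a) 1) * B\<^sup>2"
    using \<open>\<delta> \<le> tent_corr (0::'a)\<close> by (simp add: algebra_simps)
  moreover have "0 < 1 + t\<^sup>2" by (simp add: add_pos_nonneg)
  ultimately have "\<delta> \<le> (tent_corr (0::'a) + measure lborel (cball (0::'a) 1) * B\<^sup>2) * inverse (1 + t\<^sup>2)"
    by (simp add: field_simps)
  moreover have "\<bar>tent_deficit t v\<bar> = \<delta>"
    using True \<open>\<delta> \<ge> 0\<close> by (simp add: tent_deficit_def \<delta>_def)
  ultimately show ?thesis using True by simp
qed (simp add: tent_deficit_def)

lemma integrable_inverse_1_plus_square_Ioi:
  "integrable lborel (\<lambda>t::real. indicator {0<..} t * inverse (1 + t\<^sup>2))"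
proof -
  have "integrable lborel (\<lambda>t::real. inverse (1 + t\<^sup>2))"
    using integrable_inverse_1_plus_square by (simp add: set_integrable_def einterval_eq)
  then show ?thesis
    using integrable_mult_indicator[of "{0<..}" lborel "\<lambda>t::real. inverse (1 + t\<^sup>2)"] by simp
qed

section \<open>Lower bound for the distance energy\<close>

definition tent_kernel :: "real \<Rightarrow> 'a::euclidean_space \<times> 'a \<Rightarrow> real" where
  "tent_kernel t p = tent_corr ((fst p - snd p) /\<^sub>R t)"

lemma tent_kernel_measurable [measurable]: "tent_kernel t \<in> borel_measurable (borel \<Otimes>\<^sub>M borel)"
  unfolding tent_kernel_def[abs_def] by measurable

lemma tent_kernel_bounds:
  fixes p :: "'a::euclidean_space \<times> 'a"
  shows "0 \<le> tent_kernel t p" "tent_kernel t p \<le> tent_corr (0::'a)" "\<bar>tent_kernel t p\<bar> \<le> tent_corr (0::'a)"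
  using tent_corr_nonneg[of "(fst p - snd p) /\<^sub>R t"] tent_corr_le[of "(fst p - snd p) /\<^sub>R t"]
  by (auto simp: tent_kernel_def)

lemma tent_kernel_le_indicator:
  fixes x y :: "'a::euclidean_space"
  assumes "t > 0"
  shows "tent_kernel t (x, y) \<le> tent_corr (0::'a) * indicator (ball x (2 * t)) y"
proof (cases "dist x y < 2 * t")
  case False
  moreover have "norm ((x - y) /\<^sub>R t) = dist x y / t"
    using assms by (simp only: norm_scaleR) (simp add: dist_norm divide_inverse mult.commute)
  ultimately have "2 \<le> norm ((x - y) /\<^sub>R t)"
    using assms by (simp only:) (simp add: field_simps)
  then show ?thesis using False by (simp add: tent_kernel_def tent_corr_eq_0)
qed (use tent_kernel_bounds in simp)

context
  fixes R :: real and P Q :: "'a::euclidean_space measure"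
  assumes P: "prob_on_ball R P" and Q: "prob_on_ball R Q"
begin

text \<open>The kernel is an integral over centres \<open>w\<close> of products
  \<open>f w x * f w y\<close>, so its energy is an integral of squares.\<close>

lemma energy_tent_kernel_nonneg:
  assumes t: "t > 0"
  shows "0 \<le> energy P Q (tent_kernel t)"
proof -
  define f where "f w x = tent (w - x /\<^sub>R t)" for w x :: 'a
  define F where "F p w = f w (fst p) * f w (snd p)" for p w
  \<comment> \<open>Rescaled points have norm below \<open>R / t\<close> and tents have radius
    \<open>1\<close>, so centres beyond \<open>?r\<close> contribute nothing.\<close>
  let ?r = "R / t + 1"
  have M: "sigma_finite_measure (lborel :: 'a measure)" by unfold_locales
  have F_meas: "case_prod F \<in> borel_measurable ((borel \<Otimes>\<^sub>M borel) \<Otimes>\<^sub>M lborel)"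
    unfolding F_def f_def by measurable
  have dom: "\<bar>F (x, y) w\<bar> \<le> indicator (cball 0 ?r) w" if "norm x < R" "norm y < R" for x y w
  proof (cases "norm w \<le> ?r")
    case True
    have "f w x * f w y \<le> 1 * 1"
      by (intro mult_mono) (auto simp: f_def tent_bounds)
    then show ?thesis using True by (simp add: F_def f_def tent_bounds)
  next
    case False
    have "norm (x /\<^sub>R t) \<le> R / t" using that t by (simp add: field_simps)
    then have "1 \<le> norm (w - x /\<^sub>R t)"
      using False norm_triangle_ineq2[of w "x /\<^sub>R t"] by simp
    then show ?thesis by (simp add: F_def f_def tent_eq_0)
  qed
  have "energy P Q (tent_kernel t) = energy P Q (\<lambda>p. \<integral>w. F p w \<partial>lborel)"
    by (rule arg_cong[where f="energy P Q"])
      (simp add: fun_eq_iff F_def f_def tent_kernel_def tent_corr_translate scaleR_diff_right)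
  also have "\<dots> = (\<integral>w. energy P Q (\<lambda>p. F p w) \<partial>lborel)"
    by (rule energy_integral(2)[OF P Q M F_meas dom integrable_indicator_cball])
  also have "\<dots> \<ge> 0"
  proof (rule Bochner_Integration.integral_nonneg)
    fix w :: 'a
    have "f w \<in> borel_measurable borel" unfolding f_def[abs_def] by measurable
    then have "energy P Q (\<lambda>p. F p w) = ((\<integral>x. f w x \<partial>P) - (\<integral>x. f w x \<partial>Q))\<^sup>2"
      unfolding F_def by (rule energy_mult[OF P Q, where C=1]) (simp add: f_def tent_bounds)
    then show "0 \<le> energy P Q (\<lambda>p. F p w)" by simp
  qed
  finally show ?thesis .
qed

lemma tent_deficit_measurable [measurable]:
  "case_prod (\<lambda>p t. tent_deficit t (fst p - snd p)) \<in> borel_measurable ((borel \<Otimes>\<^sub>M borel) \<Otimes>\<^sub>M (lborel :: real measure))"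
  unfolding tent_deficit_def by measurable

text \<open>The integral over scales represents \<open>C * norm (x - y)\<close>, hence minus its
  energy is the integral of the energies of \<open>tent_kernel t\<close>. These are nonnegative, so
  the range may be cut down to \<open>t \<le> t0\<close>.\<close>

lemma energy_norm_ge:
  assumes C: "\<And>v::'a. (\<integral>t. tent_deficit t v \<partial>lborel) = C * norm v"
    and \<delta>: "\<And>t. 0 < t \<Longrightarrow> t \<le> t0 \<Longrightarrow> \<delta> \<le> energy P Q (tent_kernel t)" and "0 \<le> t0"
  shows "t0 * \<delta> \<le> C * - energy P Q (\<lambda>p. norm (fst p - snd p))"
proof -
  let ?F = "\<lambda>p t. tent_deficit t (fst p - snd p :: 'a)"
  let ?h = "\<lambda>t. (tent_corr (0::'a) + measure lborel (cball (0::'a) 1) * (2 * R)\<^sup>2)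
      * (indicator {0<..} t * inverse (1 + t\<^sup>2))"
  have M: "sigma_finite_measure (lborel :: real measure)" by unfold_locales
  have diff: "norm (x - y) \<le> 2 * R" if "norm x < R" "norm y < R" for x y :: 'a
    using norm_triangle_ineq4[of x y] that by simp
  have dom: "\<bar>?F (x, y) t\<bar> \<le> ?h t" if "norm x < R" "norm y < R" for x y t
    using tent_deficit_bound[OF diff[OF that]] by simp
  have h: "integrable lborel ?h"
    by (intro integrable_mult_right integrable_inverse_1_plus_square_Ioi)
  \<comment> \<open>The constant \<open>tent_corr 0\<close> has zero energy, which leaves the kernel
    with reversed sign.\<close>
  have kernel: "energy P Q (\<lambda>p. ?F p t) = - (indicator {0<..} t * energy P Q (tent_kernel t))" for t
  proof (cases "t > 0")
    case True
    have "energy P Q (\<lambda>p. ?F p t) = energy P Q (\<lambda>p. tent_corr (0::'a) + 0 + (- 1) * tent_kernel t p)"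
      using True by (simp add: tent_deficit_def tent_kernel_def)
    also have "\<dots> = (- 1) * energy P Q (tent_kernel t)"
      by (rule energy_affine[OF P Q, where C="tent_corr (0::'a)"])
        (auto simp: tent_kernel_bounds tent_corr_nonneg)
    finally show ?thesis using True by simp
  qed (simp add: tent_deficit_def energy_def)
  have "t0 * \<delta> = (\<integral>t. indicator {0<..t0} t * \<delta> \<partial>lborel)"
    using \<open>0 \<le> t0\<close> by simp
  also have "\<dots> \<le> (\<integral>t. indicator {0<..} t * energy P Q (tent_kernel t) \<partial>lborel)"
  proof (rule integral_mono)
    show "integrable lborel (\<lambda>t. indicator {0<..t0} t * \<delta>)"
      using \<open>0 \<le> t0\<close> by simp
    show "integrable lborel (\<lambda>t. indicator {0<..} t * energy P Q (tent_kernel t))"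
      using energy_integral(1)[OF P Q M tent_deficit_measurable dom h] by (simp add: kernel)
    show "indicator {0<..t0} t * \<delta> \<le> indicator {0<..} t * energy P Q (tent_kernel t)" for t
      using \<delta>[of t] energy_tent_kernel_nonneg[of t] by (auto simp: indicator_def)
  qed
  also have "\<dots> = - energy P Q (\<lambda>p. \<integral>t. ?F p t \<partial>lborel)"
    using energy_integral(2)[OF P Q M tent_deficit_measurable dom h] by (simp add: kernel)
  also have "\<dots> = - energy P Q (\<lambda>p. 0 + 0 + C * norm (fst p - snd p))"
    by (simp add: C)
  also have "\<dots> = - (C * energy P Q (\<lambda>p. norm (fst p - snd p)))"
    by (subst energy_affine[OF P Q, where C="\<bar>2 * R\<bar>"]) (auto intro: order_trans[OF diff])
  finally show ?thesis by simp
qed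

text \<open>For each \<open>x\<close> the kernel is supported in a ball of \<open>Q\<close>-mass at
  most \<open>b\<close>, and averaging over \<open>x\<close> with the probability \<open>P\<close>
  keeps the bound. Symmetry of the kernel gives the other order.\<close>

lemma tent_kernel_cross_le:
  assumes t: "t > 0" and b: "\<And>x. measure Q (ball x (2 * t)) \<le> b"
  shows "(\<integral>p. tent_kernel t p \<partial>(P \<Otimes>\<^sub>M Q)) \<le> tent_corr (0::'a) * b"
    and "(\<integral>p. tent_kernel t p \<partial>(Q \<Otimes>\<^sub>M P)) \<le> tent_corr (0::'a) * b"
proof -
  interpret P: prob_space P using P by (simp add: prob_on_ball_def)
  interpret Q: prob_space Q using Q by (simp add: prob_on_ball_def)
  interpret PQ: pair_sigma_finite P Q ..
  interpret QP: pair_sigma_finite Q P ..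
  have sets [measurable_cong]: "sets P = sets borel" "sets Q = sets borel"
    using P Q by (auto simp: prob_on_ball_def)
  have PQ_int: "integrable (P \<Otimes>\<^sub>M Q) (tent_kernel t)"
    by (rule prob_on_ball_pair_integrable[OF P Q, where B="tent_corr (0::'a)"]) (auto simp: tent_kernel_bounds)
  have "(\<integral>y. tent_kernel t (x, y) \<partial>Q) \<le> tent_corr (0::'a) * b" for x
  proof -
    have "(\<integral>y. tent_kernel t (x, y) \<partial>Q) \<le> (\<integral>y. tent_corr (0::'a) * indicator (ball x (2 * t)) y \<partial>Q)"
      using tent_kernel_le_indicator[OF t, of x]
      by (intro integral_mono' tent_kernel_bounds integrable_mult_right integrable_real_indicator)
         (auto simp: Q.emeasure_eq_measure sets tent_corr_nonneg)
    also have "\<dots> = tent_corr (0::'a) * measure Q (ball x (2 * t))"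
      by (simp add: sets_eq_imp_space_eq[OF sets(2)])
    also have "\<dots> \<le> tent_corr (0::'a) * b"
      by (intro mult_left_mono b tent_corr_nonneg)
    finally show ?thesis .
  qed
  then have "(\<integral>x. (\<integral>y. tent_kernel t (x, y) \<partial>Q) \<partial>P) \<le> tent_corr (0::'a) * b"
    using PQ.integrable_fst'[OF PQ_int] by (intro P.integral_le_const) auto
  then show *: "(\<integral>p. tent_kernel t p \<partial>(P \<Otimes>\<^sub>M Q)) \<le> tent_corr (0::'a) * b"
    using PQ.integral_fst'[OF PQ_int] by simp
  have "tent_kernel t p = tent_kernel t (snd p, fst p)" for p :: "'a \<times> 'a"
    unfolding tent_kernel_def by (rule tent_corr_radial) (simp add: norm_minus_commute)
  then have swap: "tent_kernel t = (\<lambda>(x, y). tent_kernel t (y, x :: 'a))"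
    unfolding split_beta' by (rule ext)
  have "(\<integral>p. tent_kernel t p \<partial>(Q \<Otimes>\<^sub>M P)) = (\<integral>p. tent_kernel t p \<partial>(P \<Otimes>\<^sub>M Q))"
    unfolding PQ.integral_product_swap[OF borel_measurable_integrable[OF PQ_int], folded swap] ..
  then show "(\<integral>p. tent_kernel t p \<partial>(Q \<Otimes>\<^sub>M P)) \<le> tent_corr (0::'a) * b"
    using * by simp
qed

end

section \<open>The empirical measure and its diagonal contribution\<close>

definition empirical_measure :: "nat \<Rightarrow> (nat \<Rightarrow> 'a::euclidean_space) \<Rightarrow> 'a measure" where
  "empirical_measure N z = distr (measure_pmf (pmf_of_set {..<N})) borel z"

text \<open>The uniform law on indices is pushed forward, so coinciding points count with
  multiplicity; \<open>N \<ge> 1\<close> makes the index set nonempty.\<close>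

lemma integral_empirical_measure:
  fixes f :: "'a::euclidean_space \<Rightarrow> real"
  assumes "N \<ge> 1" and [measurable]: "f \<in> borel_measurable borel"
  shows "(\<integral>x. f x \<partial>empirical_measure N z) = (\<Sum>j<N. f (z j)) / real N"
proof -
  have "{..<N} \<noteq> {}" using assms(1) by (cases N) auto
  then show ?thesis by (simp add: empirical_measure_def integral_distr integral_pmf_of_set)
qed

lemma prob_on_ball_empirical_measure:
  assumes "N \<ge> 1" and z: "\<forall>j<N. z j \<in> ball 0 R"
  shows "prob_on_ball R (empirical_measure N z)"
proof -
  have "{..<N} \<noteq> {}" using \<open>N \<ge> 1\<close> by (cases N) auto
  then have "AE j in measure_pmf (pmf_of_set {..<N}). norm (z j) < R"
    using z by (auto simp: AE_measure_pmf_iff)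
  then show ?thesis
    unfolding prob_on_ball_def empirical_measure_def
    by (auto simp: AE_distr_iff intro!: prob_space.prob_space_distr prob_space_measure_pmf)
qed

lemma measure_empirical_measure:
  assumes "N \<ge> 1" and [measurable]: "A \<in> sets borel"
  shows "real N * measure (empirical_measure N z) A = (\<Sum>j<N. indicator A (z j))"
  using integral_empirical_measure[OF assms(1), of "indicator A" z] assms(1)
  by (simp add: empirical_measure_def field_simps)

text \<open>The diagonal contributes at least \<open>tent_corr 0 / N\<close>, the two cross terms
  take away at most a quarter of this each, and the \<open>Q\<close>-\<open>Q\<close> term is
  nonnegative.\<close>

lemma energy_empirical_ge:
  fixes z :: "nat \<Rightarrow> 'a::euclidean_space"
  assumes N: "N \<ge> 1" and z: "\<forall>j<N. z j \<in> ball 0 R" and Q: "prob_on_ball R Q"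
    and t: "t > 0" and b: "\<And>x. measure Q (ball x (2 * t)) \<le> 1 / (4 * real N)"
  shows "tent_corr (0::'a) / (2 * real N) \<le> energy (empirical_measure N z) Q (tent_kernel t)"
proof -
  define P where "P = empirical_measure N z"
  have P: "prob_on_ball R P" unfolding P_def by (rule prob_on_ball_empirical_measure[OF N z])
  interpret P: prob_space P using P by (simp add: prob_on_ball_def)
  interpret PP: pair_sigma_finite P P ..
  have int: "integrable (P \<Otimes>\<^sub>M P) (tent_kernel t)"
    by (rule prob_on_ball_pair_integrable[OF P P, where B="tent_corr (0::'a)"]) (auto simp: tent_kernel_bounds)
  have "tent_corr (0::'a) / real N = (\<Sum>i<N. tent_corr (0::'a) / real N) / real N"
    using N by simp
  \<comment> \<open>Off-diagonal terms are nonnegative and are dropped.\<close>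
  also have "\<dots> \<le> (\<Sum>i<N. (\<Sum>j<N. tent_kernel t (z i, z j)) / real N) / real N"
  proof (intro divide_right_mono sum_mono)
    fix i assume "i \<in> {..<N}"
    then have "tent_kernel t (z i, z i) \<le> (\<Sum>j<N. tent_kernel t (z i, z j))"
      by (intro member_le_sum) (auto simp: tent_kernel_bounds)
    then show "tent_corr (0::'a) \<le> (\<Sum>j<N. tent_kernel t (z i, z j))"
      by (simp add: tent_kernel_def)
  qed simp_all
  also have "\<dots> = (\<Sum>i<N. (\<integral>y. tent_kernel t (z i, y) \<partial>P)) / real N"
  proof -
    have "(\<integral>y. tent_kernel t (x, y) \<partial>P) = (\<Sum>j<N. tent_kernel t (x, z j)) / real N" for x
    proof -
      have "(\<lambda>y. tent_kernel t (x, y)) \<in> borel_measurable borel"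
        unfolding tent_kernel_def fst_conv snd_conv by measurable
      then show ?thesis unfolding P_def by (rule integral_empirical_measure[OF N])
    qed
    then show ?thesis by simp
  qed
  also have "\<dots> = (\<integral>x. (\<integral>y. tent_kernel t (x, y) \<partial>P) \<partial>P)"
  proof -
    have "sets P = sets borel" using P by (simp add: prob_on_ball_def)
    from measurable_cong_sets[OF this refl]
    have "(\<lambda>x. \<integral>y. tent_kernel t (x, y) \<partial>P) \<in> borel_measurable borel"
      using borel_measurable_integrable[OF PP.integrable_fst'[OF int]] by blast
    from integral_empirical_measure[OF N this, of z, folded P_def] show ?thesis by (rule sym)
  qed
  also have "\<dots> = (\<integral>p. tent_kernel t p \<partial>(P \<Otimes>\<^sub>M P))"
    by (rule PP.integral_fst'[OF int])
  finally have "tent_corr (0::'a) / real N \<le> (\<integral>p. tent_kernel t p \<partial>(P \<Otimes>\<^sub>M P))" .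
  moreover have "0 \<le> (\<integral>p. tent_kernel t p \<partial>(Q \<Otimes>\<^sub>M Q))"
    by (simp add: tent_kernel_bounds)
  moreover have "tent_corr (0::'a) * (1 / (4 * real N)) = tent_corr (0::'a) / real N / 4"
      "tent_corr (0::'a) / (2 * real N) = tent_corr (0::'a) / real N / 2"
    by simp_all
  ultimately show ?thesis
    using tent_kernel_cross_le[OF P Q t b] unfolding energy_def P_def[symmetric]
    by linarith
qed

text \<open>The complement of the support is a union of null balls, and Lindelof reduces it to a
  countable one. It is therefore null, which also gives measurability of the support and total mass
  \<open>1\<close>.\<close>

lemma prob_on_ball_support:
  fixes \<mu> :: "'a::euclidean_space measure"
  assumes sets: "sets \<mu> = sets borel" and one: "emeasure \<mu> (measure_support \<mu>) = 1"
    and R: "measure_support \<mu> \<subseteq> ball 0 R"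
  shows "prob_on_ball R \<mu>"
proof -
  define \<F> where "\<F> = {ball x r |x r. r > 0 \<and> emeasure \<mu> (ball x r) = 0}"
  have "openin (top_of_set UNIV) S" if "S \<in> \<F>" for S
    using that by (auto simp: \<F>_def)
  then obtain \<G> where \<G>: "\<G> \<subseteq> \<F>" "countable \<G>" "\<Union>\<G> = \<Union>\<F>"
    by (rule Lindelof_openin)
  have space: "space \<mu> = UNIV" using sets_eq_imp_space_eq[OF sets] by simp
  have compl: "- measure_support \<mu> = \<Union>\<F>"
  proof safe
    fix x assume "x \<notin> measure_support \<mu>"
    then obtain r where "r > 0" "emeasure \<mu> (ball x r) = 0"
      by (auto simp: measure_support_def)
    then show "x \<in> \<Union>\<F>" unfolding \<F>_def by (intro UnionI[where X="ball x r"] CollectI exI[of _ x] exI[of _ r]) simp_all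
  next
    fix x A assume x: "x \<in> measure_support \<mu>" and "A \<in> \<F>" "x \<in> A"
    then obtain y r where A: "A = ball y r" "emeasure \<mu> A = 0" by (auto simp: \<F>_def)
    \<comment> \<open>A null ball containing \<open>x\<close> contains a smaller ball centred at
      \<open>x\<close>, contradicting membership in the support.\<close>
    have "ball x (r - dist y x) \<subseteq> A"
    proof
      fix w assume "w \<in> ball x (r - dist y x)"
      then show "w \<in> A" using dist_triangle[of y w x] A by simp
    qed
    moreover have "A \<in> sets \<mu>" using A by (simp only: sets) simp
    ultimately have "emeasure \<mu> (ball x (r - dist y x)) = 0"
      using A(2) by (rule emeasure_eq_0[rotated 2])
    moreover have "r - dist y x > 0" using \<open>x \<in> A\<close> A by simp
    ultimately show False using x unfolding measure_support_def mem_Collect_eq by (metis less_irrefl)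
  qed
  have null: "- measure_support \<mu> \<in> null_sets \<mu>"
  proof -
    have "(\<Union>A\<in>\<G>. A) \<in> null_sets \<mu>"
    proof (rule null_sets_UN'[OF \<G>(2)])
      have "\<F> \<subseteq> null_sets \<mu>" by (auto simp: \<F>_def null_sets_def sets)
      then show "A \<in> null_sets \<mu>" if "A \<in> \<G>" for A using \<G>(1) that by blast
    qed
    then show ?thesis using compl \<G>(3) by simp
  qed
  have meas: "measure_support \<mu> \<in> sets \<mu>"
  proof -
    have "measure_support \<mu> = space \<mu> - (- measure_support \<mu>)" by (auto simp: space)
    then show ?thesis using sets.compl_sets[OF null_setsD2[OF null]] by metis
  qed
  have "emeasure \<mu> (space \<mu>) = emeasure \<mu> (measure_support \<mu> \<union> - measure_support \<mu>)"
    by (simp add: space)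
  also have "\<dots> = 1" using emeasure_Un_null_set[OF meas null] one by simp
  finally have "prob_space \<mu>" by (rule prob_spaceI)
  moreover have "AE x in \<mu>. norm x < R"
    using AE_not_in[OF null] by eventually_elim (use R in \<open>simp add: subset_iff\<close>)
  ultimately show ?thesis using sets by (simp add: prob_on_ball_def)
qed

section \<open>Choice of the scale and assembly of the constants\<close>

theorem theorem5:
  fixes \<mu> :: "'a::euclidean_space measure"
    and \<alpha> c0 r0 :: real
  assumes dim: "DIM('a) \<ge> 2"
    and borel: "sets \<mu> = sets borel"
    and supp_one: "emeasure \<mu> (measure_support \<mu>) = 1"
    and alpha: "0 < \<alpha>" "\<alpha> \<le> real DIM('a)"
    and c0: "c0 > 0"
    and ball_growth: "\<And>x r. r > 0 \<Longrightarrow> emeasure \<mu> (ball x r) \<le> ennreal (c0 * r powr \<alpha>)"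
    and supp_bdd: "measure_support \<mu> \<subseteq> ball 0 r0"
  shows "\<exists>c>0. \<forall>N::nat. \<forall>z::nat \<Rightarrow> 'a. N \<ge> 1 \<longrightarrow> (\<forall>j<N. z j \<in> ball 0 r0) \<longrightarrow>
           ennreal ((c * real N powr (1/2 - 1/(2*\<alpha>)))\<^sup>2)
             \<le> (\<integral>\<^sup>+ \<rho>\<in>{0<..}. (\<integral>\<^sup>+ \<Theta>. ennreal ((discrepancy \<mu> N z (halfspace \<rho> \<Theta>))\<^sup>2) \<partial>sphere_measure) \<partial>lborel)"
proof -
  have \<mu>: "prob_on_ball r0 \<mu>" by (rule prob_on_ball_support[OF borel supp_one supp_bdd])
  obtain s where s: "s > 0" "\<And>v::'a. (\<integral>\<Theta>. \<bar>v \<bullet> \<Theta>\<bar> \<partial>sphere_measure) = s * norm v"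
    using integral_sphere_measure_inner by blast
  obtain C where C: "\<And>v::'a. (\<integral>t. tent_deficit t v \<partial>lborel) = C * norm v"
    using tent_deficit_integral by blast
  define \<tau> where "\<tau> = tent_corr (0::'a)"
  \<comment> \<open>\<open>b\<close> collects \<open>s / 4\<close>, the factor \<open>1/2\<close> in
    \<open>t0\<close>, the \<open>\<tau> / 2\<close> of the diagonal bound and the division by
    \<open>\<bar>C\<bar> + 1\<close>. The bound is for the square, so the final constant is
    \<open>sqrt b\<close>.\<close>
  define b where "b = s * \<tau> * (4 * c0) powr (- (1 / \<alpha>)) / (16 * (\<bar>C\<bar> + 1))"
  have b: "b > 0" using s(1) tent_corr_0_pos c0 unfolding b_def \<tau>_def
    by (intro divide_pos_pos mult_pos_pos) auto
  have bound: "ennreal ((sqrt b * real N powr (1/2 - 1/(2*\<alpha>)))\<^sup>2)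
             \<le> (\<integral>\<^sup>+ \<rho>\<in>{0<..}. (\<integral>\<^sup>+ \<Theta>. ennreal ((discrepancy \<mu> N z (halfspace \<rho> \<Theta>))\<^sup>2) \<partial>sphere_measure) \<partial>lborel)"
    if N: "N \<ge> 1" and z: "\<forall>j<N. z j \<in> ball 0 r0" for N and z :: "nat \<Rightarrow> 'a"
  proof -
    define P where "P = empirical_measure N z"
    have P: "prob_on_ball r0 P" unfolding P_def by (rule prob_on_ball_empirical_measure[OF N z])
    have disc: "discrepancy \<mu> N z (halfspace \<rho> \<Theta>)
        = real N * (measure P (halfspace \<rho> \<Theta>) - measure \<mu> (halfspace \<rho> \<Theta>))" for \<rho> \<Theta>
    proof -
      have "halfspace \<rho> \<Theta> \<in> sets borel" unfolding halfspace_def by measurable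
      then show ?thesis
        by (simp add: P_def discrepancy_def right_diff_distrib measure_empirical_measure[OF N])
    qed
    define E where "E = - energy P \<mu> (\<lambda>p. norm (fst p - snd p))"
    \<comment> \<open>Chosen so that \<open>c0 * (2 * t0) powr \<alpha> = 1 / (4 * N)\<close>, the
      largest ball mass that the diagonal estimate tolerates.\<close>
    define t0 where "t0 = (4 * c0 * real N) powr (- (1 / \<alpha>)) / 2"
    have "t0 > 0" using c0 N by (simp add: t0_def)
    have "\<tau> / (2 * real N) \<le> energy P \<mu> (tent_kernel t)" if t: "0 < t" "t \<le> t0" for t
      unfolding P_def \<tau>_def
    proof (rule energy_empirical_ge[OF N z \<mu> t(1)])
      fix x :: 'a
      have "(2 * t) powr \<alpha> \<le> (2 * t0) powr \<alpha>"
        using t alpha(1) by (intro powr_mono2) auto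
      also have "\<dots> = 1 / (4 * c0 * real N)"
        using c0 N alpha(1) by (simp add: t0_def powr_powr powr_neg_one)
      finally have "c0 * (2 * t) powr \<alpha> \<le> 1 / (4 * real N)"
        using c0 N by (simp add: field_simps)
      moreover have "measure \<mu> (ball x (2 * t)) \<le> c0 * (2 * t) powr \<alpha>"
        unfolding measure_def using ball_growth[of "2 * t" x] t c0 by (intro enn2real_leI) auto
      ultimately show "measure \<mu> (ball x (2 * t)) \<le> 1 / (4 * real N)" by simp
    qed
    then have "t0 * (\<tau> / (2 * real N)) \<le> C * E"
      unfolding E_def using \<open>t0 > 0\<close> by (intro energy_norm_ge[OF P \<mu> C]) auto
    \<comment> \<open>Nonnegativity of \<open>E\<close> allows \<open>C\<close>, whose sign is not
      recorded, to be replaced by the positive number \<open>\<bar>C\<bar> + 1\<close>, by which one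
      can divide.\<close>
    moreover have "0 \<le> E"
      using halfspace_discrepancy_energy(1)[OF P \<mu> s(2)] s(1) by (simp add: E_def mult_le_0_iff)
    then have "C * E \<le> (\<bar>C\<bar> + 1) * E" by (intro mult_right_mono) auto
    ultimately have E: "t0 * (\<tau> / (2 * real N)) / (\<bar>C\<bar> + 1) \<le> E"
      by (subst pos_divide_le_eq) (auto simp: mult.commute)
    have "(sqrt b * real N powr (1/2 - 1/(2*\<alpha>)))\<^sup>2 = b * real N powr (1 - 1 / \<alpha>)"
    proof -
      have "(real N powr (1/2 - 1/(2*\<alpha>)))\<^sup>2 = real N powr ((1/2 - 1/(2*\<alpha>)) + (1/2 - 1/(2*\<alpha>)))"
        unfolding power2_eq_square powr_add ..
      also have "(1/2 - 1/(2*\<alpha>)) + (1/2 - 1/(2*\<alpha>)) = 1 - 1 / \<alpha>" by (simp add: field_simps)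
      finally show ?thesis using b by (simp add: power_mult_distrib)
    qed
    also have "\<dots> = (real N)\<^sup>2 * (s / 4 * (t0 * (\<tau> / (2 * real N)) / (\<bar>C\<bar> + 1)))"
    proof -
      have "real N powr (1 - 1 / \<alpha>) = real N * real N powr (- (1 / \<alpha>))"
        using N by (simp add: powr_diff powr_minus divide_inverse)
      moreover have "t0 = (4 * c0) powr (- (1 / \<alpha>)) * real N powr (- (1 / \<alpha>)) / 2"
        using c0 by (simp add: t0_def powr_mult)
      moreover have "s * \<tau> * v / (16 * d) * (n * u) = n\<^sup>2 * (s / 4 * (v * u / 2 * (\<tau> / (2 * n)) / d))"
        if "n \<noteq> 0" "d \<noteq> 0" for n d u v :: real
        using that by (simp add: power2_eq_square field_simps)
      moreover have "\<bar>C\<bar> + 1 \<noteq> 0" "real N \<noteq> 0" using N by auto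
      ultimately show ?thesis
        by (simp only: b_def)
    qed
    also have "\<dots> \<le> (real N)\<^sup>2 * (s / 4 * E)"
      using E s(1) by (intro mult_left_mono) auto
    also have "\<dots> = (real N)\<^sup>2 * (- (s / 4) * energy P \<mu> (\<lambda>p. norm (fst p - snd p)))"
      by (simp add: E_def)
    finally have "ennreal ((sqrt b * real N powr (1/2 - 1/(2*\<alpha>)))\<^sup>2)
        \<le> ennreal ((real N)\<^sup>2 * (- (s / 4) * energy P \<mu> (\<lambda>p. norm (fst p - snd p))))"
      by (rule ennreal_leI)
    also have "\<dots> \<le> (\<integral>\<^sup>+\<rho>\<in>{0<..}. (\<integral>\<^sup>+\<Theta>. ennreal ((real N * (measure P (halfspace \<rho> \<Theta>)
           - measure \<mu> (halfspace \<rho> \<Theta>)))\<^sup>2) \<partial>sphere_measure) \<partial>lborel)"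
      by (rule halfspace_discrepancy_energy(2)[OF P \<mu> s(2)])
    finally show ?thesis by (simp only: disc)
  qed
  show ?thesis
    using b bound by (intro exI[of _ "sqrt b"]) auto
qed

end
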